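(* Consider the SAV/CN scheme: for $n\ge 1$, given $\phi^{n},\mathcal{R}^{n}$ and $\phi^{n-1},\mathcal{R}^{n-1}$, update $\phi^{n+1}$ and $\mathcal{R}^{n+1}$ by $$\frac{\phi^{n+1}-\phi^{n}}{\tau^{n}}=-\mathcal{W}^{n+1/2},$$ $$\mathcal{W}^{n+1/2}=\mathcal{G}^2\phi^{n+1/2}+\frac{\mathcal{R}^{n+1/2}}{\sqrt{F_1(\bar\phi^{n+1/2})}}\,\mathcal{N}'(\bar\phi^{n+1/2}),$$ $$\frac{\mathcal{R}^{n+1}-\mathcal{R}^{n}}{\tau^{n}}=\left\langle\frac{\mathcal{N}'(\bar\phi^{n+1/2})}{2\sqrt{F_1(\bar\phi^{n+1/2})}},\frac{\phi^{n+1}-\phi^{n}}{\tau^{n}}\right\rangle_{AP},$$ where $\mathcal{R}^{n+1/2}=(\mathcal{R}^{n+1}+\mathcal{R}^{n})/2$, $\phi^{n+1/2}=(\phi^{n+1}+\phi^{n})/2$ and $\bar\phi^{n+1/2}=(3\phi^{n}-\phi^{n-1})/2$. The SAV/CN scheme satisfies the energy dissipation mechanism $$\mathcal{F}^{n+1}_{SAV/CN}-\mathcal{F}^{n}_{SAV/CN}\le 0,$$ where $$\mathcal{F}^{n}_{SAV/CN}=\frac12\|\mathcal{G}\phi^{n}\|_{AP}^2+(\mathcal{R}^{n})^2-C_1 .$$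
   Context: Almost periodic functions: for a real- or complex-valued function $f$ on $\mathbb{R}^d$ and $\epsilon>0$, a vector $\zeta\in\mathbb{R}^d$ is an $\epsilon$-almost period of $f$ if $|f(\boldsymbol r-\zeta)-f(\boldsymbol r)|<\epsilon$ for all $\boldsymbol r\in\mathbb{R}^d$; $f$ is almost periodic on $\mathbb{R}^d$ if it is continuous and for every $\epsilon>0$ there is a number $L=L(\epsilon,f)$ such that any cube of side length $L$ in $\mathbb{R}^d$ contains an $\epsilon$-almost period of $f$. The almost periodic inner product is $\langle f,g\rangle_{AP}=\lim_{R\to\infty}\frac{1}{|Q(R)|}\int_{Q(R)}f(\boldsymbol r)g(\boldsymbol r)\,d\boldsymbol r$ with $Q(R)=[-R,R]^d$ and $|Q(R)|$ its measure, and the norm is given by $\|f\|_{AP}^2=\langle f,f\rangle_{AP}$. Model: $d\in\{1,2,3\}$, $m\in\mathbb{N}$, $q_1,\dots,q_m$ are the characteristic length-scales (real parameters), $\tilde\varepsilon,\tilde\alpha$ are real model parameters, $\Delta$ is the Laplacian on $\mathbb{R}^d$, and $$\mathcal{G}=\prod_{j=1}^m(\Delta+q_j^2),\qquad \mathcal{N}(\phi)=\frac{\tilde\varepsilon}{2}\phi^2-\frac{\tilde\alpha}{3}\phi^3+\frac14\phi^4,$$ with $\mathcal{N}'(\phi)=\tilde\varepsilon\phi-\tilde\alpha\phi^2+\phi^3$. The associated energy is $\frac12\|\mathcal{G}\phi\|_{AP}^2+\langle\mathcal{N}(\phi),1\rangle_{AP}$, and the scheme discretizes its Allen-Cahn gradient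 flow $\phi_t=-(\mathcal{G}^2\phi+\mathcal{N}'(\phi))$ by means of the scalar auxiliary variable $\mathcal{R}=\sqrt{F_1(\phi)}$. Here $F_1(\phi)=\langle\mathcal{N}(\phi),1\rangle_{AP}+C_1$, where $C_1$ is a positive constant, and it is supposed that $F_1(\phi)\ge0$. Time discretization: $[0,T]$ is partitioned as $0=t^0<t^1<\dots<t^{N_T}=T$ with time step sizes $\tau^n=t^{n+1}-t^n$. The $\phi^n$ are the order parameters (real-valued functions on $\mathbb{R}^d$, considered in the almost periodic setting) at time level $t^n$, and the $\mathcal{R}^n$ are the real values of the auxiliary variable at time level $t^n$, obtained from the iteration. *)

theory Defs
  imports "HOL-Analysis.Analysis"
begin

section \<open>Almost periodic functions\<close>

definition almost_period :: "real \<Rightarrow> (real^'d \<Rightarrow> 'b::real_normed_vector) \<Rightarrow> real^'d \<Rightarrow> bool" where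
  "almost_period \<epsilon> f \<zeta> \<longleftrightarrow> (\<forall>r. norm (f (r - \<zeta>) - f r) < \<epsilon>)"

text \<open>
  Cubes are closed and axis-parallel. Rotated or open cubes would give the same notion, at the
  price of a larger \<open>L\<close>.
\<close>

definition almost_periodic :: "(real^'d \<Rightarrow> 'b::real_normed_vector) \<Rightarrow> bool" where
  "almost_periodic f \<longleftrightarrow>
     continuous_on UNIV f \<and>
     (\<forall>\<epsilon>>0. \<exists>L>0. \<forall>a. \<exists>\<zeta>\<in>cbox a (a + (\<chi> i. L)). almost_period \<epsilon> f \<zeta>)"

definition cubeQ :: "real \<Rightarrow> (real^'d) set" where
  "cubeQ R = cbox (\<chi> i. - R) (\<chi> i. R)"

definition ap_inner :: "(real^'d \<Rightarrow> real) \<Rightarrow> (real^'d \<Rightarrow> real) \<Rightarrow> real" where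
  "ap_inner f g =
     Lim at_top (\<lambda>R. 1 / measure lebesgue (cubeQ R :: (real^'d) set) * integral (cubeQ R) (\<lambda>r. f r * g r))"

definition ap_norm :: "(real^'d \<Rightarrow> real) \<Rightarrow> real" where
  "ap_norm f = sqrt (ap_inner f f)"


section \<open>Differential operators\<close>

definition partial_deriv :: "'d \<Rightarrow> (real^'d \<Rightarrow> real) \<Rightarrow> real^'d \<Rightarrow> real" where
  "partial_deriv i f x = deriv (\<lambda>s. f (x + s *\<^sub>R axis i 1)) 0"

definition laplacian :: "(real^'d \<Rightarrow> real) \<Rightarrow> real^'d \<Rightarrow> real" where
  "laplacian f x = (\<Sum>i\<in>UNIV. partial_deriv i (partial_deriv i f) x)"

text \<open>
  The class of \<open>k\<close> times continuously differentiable functions all of whose partial derivatives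
  of order at most \<open>k\<close> are almost periodic. It is the classical function space on which a
  differential operator of order \<open>k\<close> maps into the almost periodic functions.
\<close>

primrec ap_smooth :: "nat \<Rightarrow> (real^'d \<Rightarrow> real) \<Rightarrow> bool" where
  "ap_smooth 0 f \<longleftrightarrow> almost_periodic f"
| "ap_smooth (Suc k) f \<longleftrightarrow>
     almost_periodic f \<and> (\<forall>x. f differentiable (at x)) \<and> (\<forall>i. ap_smooth k (partial_deriv i f))"

text \<open>\<open>opG q m\<close> is the composition of the operators \<open>\<Delta> + (q j)\<^sup>2\<close> for \<open>j = 1, \<dots>, m\<close>.\<close>

primrec opG :: "(nat \<Rightarrow> real) \<Rightarrow> nat \<Rightarrow> (real^'d \<Rightarrow> real) \<Rightarrow> real^'d \<Rightarrow> real" where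
  "opG q 0 f = f"
| "opG q (Suc m) f = (\<lambda>x. laplacian (opG q m f) x + (q (Suc m))\<^sup>2 * opG q m f x)"


section \<open>The energy and the scheme\<close>

definition potN :: "real \<Rightarrow> real \<Rightarrow> real \<Rightarrow> real" where
  "potN \<epsilon> \<alpha> y = \<epsilon> / 2 * y\<^sup>2 - \<alpha> / 3 * y^3 + 1 / 4 * y^4"

definition potN' :: "real \<Rightarrow> real \<Rightarrow> real \<Rightarrow> real" where
  "potN' \<epsilon> \<alpha> y = \<epsilon> * y - \<alpha> * y\<^sup>2 + y^3"

definition F1 :: "real \<Rightarrow> real \<Rightarrow> real \<Rightarrow> (real^'d \<Rightarrow> real) \<Rightarrow> real" where
  "F1 \<epsilon> \<alpha> C1 f = ap_inner (\<lambda>r. potN \<epsilon> \<alpha> (f r)) (\<lambda>r. 1) + C1"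

text \<open>The half-level quantities carry the index \<open>n\<close> for the level \<open>n + 1/2\<close>.\<close>

definition phi_half :: "(nat \<Rightarrow> real^'d \<Rightarrow> real) \<Rightarrow> nat \<Rightarrow> real^'d \<Rightarrow> real" where
  "phi_half \<phi> n r = (\<phi> (n + 1) r + \<phi> n r) / 2"

definition R_half :: "(nat \<Rightarrow> real) \<Rightarrow> nat \<Rightarrow> real" where
  "R_half \<R> n = (\<R> (n + 1) + \<R> n) / 2"

definition phi_bar :: "(nat \<Rightarrow> real^'d \<Rightarrow> real) \<Rightarrow> nat \<Rightarrow> real^'d \<Rightarrow> real" where
  "phi_bar \<phi> n r = (3 * \<phi> n r - \<phi> (n - 1) r) / 2"

definition modified_energy ::
  "(nat \<Rightarrow> real) \<Rightarrow> nat \<Rightarrow> real \<Rightarrow> (nat \<Rightarrow> real^'d \<Rightarrow> real) \<Rightarrow> (nat \<Rightarrow> real) \<Rightarrow> nat \<Rightarrow> real" where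
  "modified_energy q m C1 \<phi> \<R> n = 1 / 2 * (ap_norm (opG q m (\<phi> n)))\<^sup>2 + (\<R> n)\<^sup>2 - C1"

end

theory Submission
  imports Defs
begin

text \<open>
  Write \<open>\<delta> = \<phi>\<^sup>n\<^sup>+\<^sup>1 - \<phi>\<^sup>n\<close>. The scheme says that \<open>\<delta> = - \<tau> W\<close>, so testing the formula for
  \<open>W\<close> with \<open>\<delta>\<close> gives \<open>\<langle>W, \<delta>\<rangle> = - \<langle>\<delta>, \<delta>\<rangle> / \<tau> \<le> 0\<close>. The left-hand side is exactly the
  increment of the modified energy. Because the linear part is taken at the midpoint and \<open>\<G>\<close> is
  symmetric, \<open>\<langle>\<G>\<^sup>2 (\<phi>\<^sup>n\<^sup>+\<^sup>1 + \<phi>\<^sup>n) / 2, \<delta>\<rangle>\<close> is the increment of \<open>\<parallel>\<G> \<phi>\<parallel>\<^sup>2 / 2\<close>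
  (\<open>half_norm_difference_opG\<close>). Because the auxiliary variable in front of the nonlinearity is taken
  at the midpoint too, the nonlinear part equals \<open>(\<R>\<^sup>n\<^sup>+\<^sup>1 + \<R>\<^sup>n) (\<R>\<^sup>n\<^sup>+\<^sup>1 - \<R>\<^sup>n)\<close> by the update
  rule for \<open>\<R>\<close>.

  What this computation presupposes is that the almost periodic inner product behaves like one: the
  limit that defines it must exist, so that it is additive, and integration by parts must hold
  without boundary terms.

  \<^item> Products and sums of almost periodic functions are almost periodic. The characterization by
    totally bounded families of translates (\<open>almost_periodic_iff_totally_bounded_translates\<close>) makes
    two functions almost periodic as a pair (\<open>almost_periodic_Pair\<close>), and a continuous function of
    the pair inherits its almost periods.
  \<^item> The averages of an almost periodic function over large cubes hardly change under translation,
    uniformly in the translation vector (\<open>cube_avg_shift_uniform\<close>). Averaging twice, over two large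
    cubes, therefore approximates both single averages, which makes the averages a Cauchy family
    (\<open>cube_avg_Cauchy\<close>).
  \<^item> The mean of a partial derivative vanishes, since the derivative is a uniform limit of difference
    quotients and the mean is translation invariant (\<open>ap_mean_partial_deriv\<close>). The product rule
    turns this into integration by parts, and two of these make the Laplacian symmetric. For \<open>\<G>\<close>
    it remains to see that its factors commute, which is a matter of linearity only.
\<close>

section \<open>Bohr almost periodic functions\<close>

text \<open>
  The working form of the definition: subtracting a suitable almost period from \<open>a\<close> lands in a fixed
  cube, so every translate is uniformly close to a translate by a vector from one compact set.
\<close>

lemma almost_periodic_translate_into_cube:
  fixes f :: "real^'d \<Rightarrow> 'b::real_normed_vector"
  assumes "almost_periodic f" "\<epsilon> > 0"
  obtains L where "L > 0"
    "\<And>a. \<exists>b\<in>cbox 0 (\<chi> i. L). \<forall>r. norm (f (r + a) - f (r + b)) < \<epsilon>"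
proof -
  obtain L where L: "L > 0" "\<And>a. \<exists>\<zeta>\<in>cbox a (a + (\<chi> i. L)). almost_period \<epsilon> f \<zeta>"
    using assms unfolding almost_periodic_def by blast
  have "\<exists>b\<in>cbox 0 (\<chi> i. L). \<forall>r. norm (f (r + a) - f (r + b)) < \<epsilon>" for a
  proof -
    obtain \<zeta> where z: "\<zeta> \<in> cbox (a - (\<chi> i. L)) (a - (\<chi> i. L) + (\<chi> i. L))" "almost_period \<epsilon> f \<zeta>"
      using L(2) by blast
    have "a - \<zeta> \<in> cbox 0 (\<chi> i. L)"
      using z(1) by (auto simp: mem_box_cart algebra_simps)
    moreover have "norm (f (r + a) - f (r + (a - \<zeta>))) < \<epsilon>" for r
    proof -
      have "norm (f (r + a - \<zeta>) - f (r + a)) < \<epsilon>"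
        using z(2) unfolding almost_period_def by blast
      then show ?thesis by (simp add: norm_minus_commute algebra_simps)
    qed
    ultimately show ?thesis by blast
  qed
  with L(1) show thesis using that by blast
qed

lemma almost_periodic_continuous:
  "almost_periodic f \<Longrightarrow> continuous_on S f"
  unfolding almost_periodic_def using continuous_on_subset by blast

text \<open>
  Translation by one and the same vector, at little cost in the values, brings the first of two nearby
  points into a compact cube and the second one close to it, where compactness gives uniform continuity.
\<close>

lemma almost_periodic_uniformly_continuous:
  fixes f :: "real^'d \<Rightarrow> 'b::real_normed_vector"
  assumes f: "almost_periodic f"
  shows "uniformly_continuous_on UNIV f"
  unfolding uniformly_continuous_on_def
proof (intro allI impI)
  fix \<epsilon> :: real assume e: "\<epsilon> > 0"
  then have e3: "\<epsilon> / 3 > 0" by simp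
  obtain L where L: "L > 0"
    "\<And>a. \<exists>b\<in>cbox 0 (\<chi> i. L). \<forall>r. norm (f (r + a) - f (r + b)) < \<epsilon> / 3"
    using almost_periodic_translate_into_cube[OF f e3] by blast
  \<comment> \<open>A margin of one around the cube leaves room for the second of two points at distance below one.\<close>
  let ?K = "cbox (\<chi> i. -1) (\<chi> i. L + 1) :: (real^'d) set"
  have "uniformly_continuous_on ?K f"
    by (intro compact_uniformly_continuous almost_periodic_continuous f compact_cbox)
  then obtain d where d: "d > 0" "\<And>x y. x \<in> ?K \<Longrightarrow> y \<in> ?K \<Longrightarrow> dist y x < d \<Longrightarrow> dist (f y) (f x) < \<epsilon> / 3"
    using e3 by (rule uniformly_continuous_onE) blast
  show "\<exists>d>0. \<forall>x\<in>UNIV. \<forall>x'\<in>UNIV. dist x' x < d \<longrightarrow> dist (f x') (f x) < \<epsilon>"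
  proof (intro exI[of _ "min d 1"] conjI ballI impI)
    show "min d 1 > 0" using d by simp
    fix x y :: "real^'d" assume xy: "dist y x < min d 1"
    obtain b where b: "b \<in> cbox 0 (\<chi> i. L)" "\<And>r. norm (f (r + x) - f (r + b)) < \<epsilon> / 3"
      using L(2) by blast
    have c: "\<bar>(y - x) $ i\<bar> \<le> 1" for i
      using component_le_norm_cart[of "y - x" i] xy by (simp add: dist_norm)
    have b_bounds: "0 \<le> b $ i" "b $ i \<le> L" for i using b(1) by (auto simp: mem_box_cart)
    have bK: "b \<in> ?K"
      unfolding mem_box_cart
    proof
      fix i
      show "(\<chi> i. -1) $ i \<le> b $ i \<and> b $ i \<le> (\<chi> i. L + 1) $ i"
        using b_bounds[of i] by simp
    qed
    have yK: "y - x + b \<in> ?K"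
      unfolding mem_box_cart
    proof (intro allI)
      fix i
      show "(\<chi> i. -1) $ i \<le> (y - x + b) $ i \<and> (y - x + b) $ i \<le> (\<chi> i. L + 1) $ i"
        using c[of i] b_bounds[of i] by (simp add: abs_le_iff)
    qed
    have 1: "dist (f x) (f b) < \<epsilon> / 3" using b(2)[of 0] by (simp add: dist_norm)
    have 2: "dist (f y) (f (y - x + b)) < \<epsilon> / 3" using b(2)[of "y - x"] by (simp add: dist_norm)
    have 3: "dist (f (y - x + b)) (f b) < \<epsilon> / 3"
      using d(2)[OF bK yK] xy by (simp add: dist_norm)
    have "dist (f y) (f x) \<le> dist (f y) (f (y - x + b)) + dist (f (y - x + b)) (f b) + dist (f x) (f b)"
      using dist_triangle[of "f y" "f b" "f (y - x + b)"] dist_triangle2[of "f y" "f x" "f b"] by linarith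
    then show "dist (f y) (f x) < \<epsilon>" using 1 2 3 by linarith
  qed
qed

lemma almost_periodic_bounded:
  fixes f :: "real^'d \<Rightarrow> 'b::real_normed_vector"
  assumes f: "almost_periodic f"
  obtains B where "B \<ge> 0" "\<And>r. norm (f r) \<le> B"
proof -
  obtain L where L: "L > 0"
    "\<And>a. \<exists>b\<in>cbox 0 (\<chi> i. L). \<forall>r. norm (f (r + a) - f (r + b)) < 1"
    using almost_periodic_translate_into_cube[OF f zero_less_one] by blast
  obtain B where B: "B \<ge> 0" "\<And>x. x \<in> cbox 0 (\<chi> i. L) \<Longrightarrow> norm (f x) \<le> B"
    using continuous_on_compact_bound[OF compact_cbox almost_periodic_continuous[OF f]] by metis
  have "norm (f a) \<le> B + 1" for a
  proof -
    obtain b where b: "b \<in> cbox 0 (\<chi> i. L)" "\<And>r. norm (f (r + a) - f (r + b)) < 1"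
      using L(2) by blast
    have "norm (f a - f b) < 1" using b(2)[of 0] by simp
    then show ?thesis using B(2)[OF b(1)] norm_triangle_sub[of "f a" "f b"] by linarith
  qed
  with B(1) show thesis by (intro that[of "B + 1"]) auto
qed

text \<open>
  Bochner's criterion, with the sup norm spelled out. Its advantage over the definition is that it
  does not ask for common almost periods when two functions are combined. Forwards, uniform continuity
  replaces the compact cube of translation vectors by a finite net of it. Backwards, if the translates
  by \<open>c\<close> and \<open>s\<close> are close then \<open>c - s\<close> is an almost period, and as \<open>s\<close> ranges over a bounded set, this
  difference stays in the cube with centre \<open>c\<close>.
\<close>

lemma almost_periodic_iff_totally_bounded_translates:
  fixes f :: "real^'d \<Rightarrow> 'b::real_normed_vector"
  shows "almost_periodic f \<longleftrightarrow> continuous_on UNIV f \<and>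
    (\<forall>\<epsilon>>0. \<exists>S. finite S \<and> (\<forall>a. \<exists>s\<in>S. \<forall>r. norm (f (r + a) - f (r + s)) < \<epsilon>))"
    (is "_ \<longleftrightarrow> _ \<and> ?TB")
proof (intro iffI conjI)
  assume f: "almost_periodic f"
  show "continuous_on UNIV f" by (rule almost_periodic_continuous[OF f])
  show ?TB
  proof (intro allI impI)
    fix \<epsilon> :: real assume "\<epsilon> > 0"
    then have e: "\<epsilon> / 2 > 0" by simp
    obtain L where L: "L > 0"
      "\<And>a. \<exists>b\<in>cbox 0 (\<chi> i. L). \<forall>r. norm (f (r + a) - f (r + b)) < \<epsilon> / 2"
      using almost_periodic_translate_into_cube[OF f e] by blast
    obtain d where d: "d > 0" "\<And>x y. dist y x < d \<Longrightarrow> dist (f y) (f x) < \<epsilon> / 2"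
      using uniformly_continuous_onE[OF almost_periodic_uniformly_continuous[OF f] e] by auto
    obtain S where S: "finite S" "(cbox 0 (\<chi> i. L) :: (real^'d) set) \<subseteq> (\<Union>x\<in>S. ball x d)"
      using compact_cbox[of 0 "(\<chi> i. L) :: real^'d"] d(1) unfolding compact_eq_totally_bounded by blast
    have "\<exists>s\<in>S. \<forall>r. norm (f (r + a) - f (r + s)) < \<epsilon>" for a
    proof -
      obtain b where b: "b \<in> cbox 0 (\<chi> i. L)" "\<And>r. norm (f (r + a) - f (r + b)) < \<epsilon> / 2"
        using L(2) by blast
      obtain s where s: "s \<in> S" "dist s b < d" using b(1) S(2) by auto
      have "norm (f (r + a) - f (r + s)) < \<epsilon>" for r
      proof -
        have "dist (f (r + s)) (f (r + b)) < \<epsilon> / 2" using s(2) by (intro d(2)) simp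
        moreover have "dist (f (r + a)) (f (r + b)) < \<epsilon> / 2" using b(2)[of r] by (simp add: dist_norm)
        ultimately have "dist (f (r + a)) (f (r + s)) < \<epsilon>"
          using dist_triangle2[of "f (r + a)" "f (r + s)" "f (r + b)"] by linarith
        then show ?thesis by (simp add: dist_norm)
      qed
      with s(1) show ?thesis by blast
    qed
    with S(1) show "\<exists>S. finite S \<and> (\<forall>a. \<exists>s\<in>S. \<forall>r. norm (f (r + a) - f (r + s)) < \<epsilon>)" by blast
  qed
next
  assume A: "continuous_on UNIV f \<and> ?TB"
  show "almost_periodic f"
    unfolding almost_periodic_def
  proof (intro conjI allI impI)
    show "continuous_on UNIV f" using A by blast
    fix \<epsilon> :: real assume "\<epsilon> > 0"
    then obtain S where S: "finite S" "\<And>a. \<exists>s\<in>S. \<forall>r. norm (f (r + a) - f (r + s)) < \<epsilon>"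
      using A by blast
    obtain B where B: "B > 0" "\<And>s. s \<in> S \<Longrightarrow> norm s \<le> B"
      using finite_imp_bounded[OF S(1)] unfolding bounded_pos by blast
    show "\<exists>L>0. \<forall>a. \<exists>\<zeta>\<in>cbox a (a + (\<chi> i. L)). almost_period \<epsilon> f \<zeta>"
    proof (intro exI[of _ "2 * B"] conjI allI)
      show "2 * B > 0" using B by simp
      fix a :: "real^'d"
      \<comment> \<open>the centre of the cube in which an almost period is sought\<close>
      define c where "c = a + (\<chi> i. B)"
      obtain s where s: "s \<in> S" "\<And>r. norm (f (r + c) - f (r + s)) < \<epsilon>" using S(2) by blast
      have "almost_period \<epsilon> f (c - s)"
        unfolding almost_period_def
      proof
        fix r
        have "norm (f (r - c + c) - f (r - c + s)) < \<epsilon>" by (rule s(2))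
        then show "norm (f (r - (c - s)) - f r) < \<epsilon>"
          by (simp add: norm_minus_commute algebra_simps)
      qed
      moreover have "c - s \<in> cbox a (a + (\<chi> i. 2 * B))"
        unfolding mem_box_cart
      proof
        fix i
        have "\<bar>s $ i\<bar> \<le> B" using component_le_norm_cart[of s i] B(2)[OF s(1)] by linarith
        then show "a $ i \<le> (c - s) $ i \<and> (c - s) $ i \<le> (a + (\<chi> i. 2 * B)) $ i"
          by (simp add: c_def abs_le_iff)
      qed
      ultimately show "\<exists>\<zeta>\<in>cbox a (a + (\<chi> i. 2 * B)). almost_period \<epsilon> f \<zeta>" by blast
    qed
  qed
qed

text \<open>
  Finite nets \<open>S\<close> and \<open>S'\<close> for the two families of translates cut the translation vectors into finitely
  many classes, one for each element of \<open>S \<times> S'\<close>. One representative of each nonempty class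
  yields a net for the pair: within a class all translates of both functions are close to each other.
\<close>

lemma almost_periodic_Pair:
  fixes f :: "real^'d \<Rightarrow> 'b::real_normed_vector" and g :: "real^'d \<Rightarrow> 'c::real_normed_vector"
  assumes f: "almost_periodic f" and g: "almost_periodic g"
  shows "almost_periodic (\<lambda>r. (f r, g r))"
  unfolding almost_periodic_iff_totally_bounded_translates
proof (intro conjI allI impI)
  show "continuous_on UNIV (\<lambda>r. (f r, g r))"
    by (intro continuous_on_Pair almost_periodic_continuous f g)
  fix \<epsilon> :: real assume "\<epsilon> > 0"
  then have e: "\<epsilon> / 4 > 0" by simp
  obtain S where S: "finite S" "\<And>a. \<exists>s\<in>S. \<forall>r. norm (f (r + a) - f (r + s)) < \<epsilon> / 4"
    using f e unfolding almost_periodic_iff_totally_bounded_translates by meson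
  obtain S' where S': "finite S'" "\<And>a. \<exists>s\<in>S'. \<forall>r. norm (g (r + a) - g (r + s)) < \<epsilon> / 4"
    using g e unfolding almost_periodic_iff_totally_bounded_translates by meson
  define near where "near p a \<longleftrightarrow> (\<forall>r. norm (f (r + a) - f (r + fst p)) < \<epsilon> / 4) \<and>
      (\<forall>r. norm (g (r + a) - g (r + snd p)) < \<epsilon> / 4)" for p a
  define c where "c p = (SOME a. near p a)" for p
  show "\<exists>S. finite S \<and> (\<forall>a. \<exists>s\<in>S. \<forall>r. norm ((f (r + a), g (r + a)) - (f (r + s), g (r + s))) < \<epsilon>)"
  proof (intro exI[of _ "c ` (S \<times> S')"] conjI allI)
    show "finite (c ` (S \<times> S'))" using S(1) S'(1) by simp
    fix a
    obtain s where s: "s \<in> S" "\<forall>r. norm (f (r + a) - f (r + s)) < \<epsilon> / 4" using S(2) by blast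
    obtain s' where s': "s' \<in> S'" "\<forall>r. norm (g (r + a) - g (r + s')) < \<epsilon> / 4" using S'(2) by blast
    have na: "near (s, s') a" using s s' by (simp add: near_def)
    then have nc: "near (s, s') (c (s, s'))" unfolding c_def by (rule someI)
    have "norm ((f (r + a), g (r + a)) - (f (r + c (s, s')), g (r + c (s, s')))) < \<epsilon>" for r
    proof -
      let ?c = "c (s, s')"
      have "dist (f (r + a)) (f (r + ?c)) < \<epsilon> / 2"
      proof -
        have "dist (f (r + a)) (f (r + s)) < \<epsilon> / 4" "dist (f (r + ?c)) (f (r + s)) < \<epsilon> / 4"
          using na nc by (simp_all add: near_def dist_norm)
        then show ?thesis using dist_triangle2[of "f (r + a)" "f (r + ?c)" "f (r + s)"] by linarith
      qed
      moreover have "dist (g (r + a)) (g (r + ?c)) < \<epsilon> / 2"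
      proof -
        have "dist (g (r + a)) (g (r + s')) < \<epsilon> / 4" "dist (g (r + ?c)) (g (r + s')) < \<epsilon> / 4"
          using na nc by (simp_all add: near_def dist_norm)
        then show ?thesis using dist_triangle2[of "g (r + a)" "g (r + ?c)" "g (r + s')"] by linarith
      qed
      moreover have "norm ((f (r + a), g (r + a)) - (f (r + ?c), g (r + ?c)))
          \<le> dist (f (r + a)) (f (r + ?c)) + dist (g (r + a)) (g (r + ?c))"
        using norm_Pair_le[of "f (r + a) - f (r + ?c)" "g (r + a) - g (r + ?c)"] by (simp add: dist_norm)
      ultimately show ?thesis by linarith
    qed
    then show "\<exists>s\<in>c ` (S \<times> S'). \<forall>r. norm ((f (r + a), g (r + a)) - (f (r + s), g (r + s))) < \<epsilon>"
      using s(1) s'(1) by blast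
  qed
qed

text \<open>
  The range is bounded, so \<open>h\<close> is uniformly continuous on it, and a fine enough almost period of \<open>f\<close> is
  an almost period of the composition.
\<close>

lemma almost_periodic_compose:
  fixes f :: "real^'d \<Rightarrow> 'b::euclidean_space" and h :: "'b \<Rightarrow> 'c::real_normed_vector"
  assumes f: "almost_periodic f" and h: "continuous_on UNIV h"
  shows "almost_periodic (\<lambda>r. h (f r))"
  unfolding almost_periodic_def
proof (intro conjI allI impI)
  show "continuous_on UNIV (\<lambda>r. h (f r))"
    using continuous_on_compose2[OF h almost_periodic_continuous[OF f]] by simp
  fix \<epsilon> :: real assume e: "\<epsilon> > 0"
  obtain B where B: "\<And>r. norm (f r) \<le> B" using almost_periodic_bounded[OF f] by blast
  have "uniformly_continuous_on (cball 0 B) h"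
    by (intro compact_uniformly_continuous continuous_on_subset[OF h]) auto
  then obtain d where d: "d > 0"
    "\<And>x y. x \<in> cball 0 B \<Longrightarrow> y \<in> cball 0 B \<Longrightarrow> dist y x < d \<Longrightarrow> dist (h y) (h x) < \<epsilon>"
    using e by (rule uniformly_continuous_onE) blast
  have "almost_period \<epsilon> (\<lambda>r. h (f r)) \<zeta>" if "almost_period d f \<zeta>" for \<zeta>
    using that d(2) B unfolding almost_period_def by (auto simp: dist_norm)
  moreover have "\<exists>L>0. \<forall>a. \<exists>\<zeta>\<in>cbox a (a + (\<chi> i. L)). almost_period d f \<zeta>"
    using f d(1) unfolding almost_periodic_def by blast
  ultimately show "\<exists>L>0. \<forall>a. \<exists>\<zeta>\<in>cbox a (a + (\<chi> i. L)). almost_period \<epsilon> (\<lambda>r. h (f r)) \<zeta>"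
    by blast
qed

lemma almost_periodic_const: "almost_periodic (\<lambda>r::real^'d. c)"
proof -
  have "almost_period \<epsilon> (\<lambda>r. c) \<zeta>" if "\<epsilon> > 0" for \<epsilon> and \<zeta> :: "real^'d"
    using that by (simp add: almost_period_def)
  moreover have "\<exists>L>0. \<forall>a. a \<in> cbox a (a + (\<chi> i. L) :: real^'d)"
    by (intro exI[of _ 1]) (simp add: mem_box_cart)
  moreover have "continuous_on UNIV (\<lambda>r::real^'d. c)" by (rule continuous_on_const)
  ultimately show ?thesis
    unfolding almost_periodic_def by blast
qed

lemma almost_periodic_lincomb:
  fixes f g :: "real^'d \<Rightarrow> real"
  assumes "almost_periodic f" "almost_periodic g"
  shows "almost_periodic (\<lambda>r. a * f r + b * g r)"
proof -
  have "continuous_on UNIV (\<lambda>p::real \<times> real. a * fst p + b * snd p)"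
    by (intro continuous_intros)
  from almost_periodic_compose[OF almost_periodic_Pair[OF assms] this]
  show ?thesis by simp
qed

lemma almost_periodic_mult:
  fixes f g :: "real^'d \<Rightarrow> real"
  assumes "almost_periodic f" "almost_periodic g"
  shows "almost_periodic (\<lambda>r. f r * g r)"
proof -
  have "continuous_on UNIV (\<lambda>p::real \<times> real. fst p * snd p)"
    by (intro continuous_intros)
  from almost_periodic_compose[OF almost_periodic_Pair[OF assms] this]
  show ?thesis by simp
qed

lemma almost_periodic_add:
  fixes f g :: "real^'d \<Rightarrow> real"
  shows "almost_periodic f \<Longrightarrow> almost_periodic g \<Longrightarrow> almost_periodic (\<lambda>r. f r + g r)"
  using almost_periodic_lincomb[of f g 1 1] by simp

lemma almost_periodic_cmult:
  fixes f :: "real^'d \<Rightarrow> real"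
  shows "almost_periodic f \<Longrightarrow> almost_periodic (\<lambda>r. c * f r)"
  using almost_periodic_lincomb[of f f c 0] by simp

lemma almost_periodic_diff:
  fixes f g :: "real^'d \<Rightarrow> real"
  shows "almost_periodic f \<Longrightarrow> almost_periodic g \<Longrightarrow> almost_periodic (\<lambda>r. f r - g r)"
  using almost_periodic_lincomb[of f g 1 "-1"] by simp

lemma almost_periodic_sum:
  fixes f :: "'i \<Rightarrow> real^'d \<Rightarrow> real"
  assumes "\<And>i. i \<in> A \<Longrightarrow> almost_periodic (f i)"
  shows "almost_periodic (\<lambda>r. \<Sum>i\<in>A. f i r)"
  using assms
  by (induction A rule: infinite_finite_induct) (auto intro: almost_periodic_const almost_periodic_add)

section \<open>The mean value of an almost periodic function\<close>

definition cube_avg :: "real \<Rightarrow> (real^'d \<Rightarrow> real) \<Rightarrow> real" where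
  "cube_avg R f = 1 / measure lebesgue (cubeQ R :: (real^'d) set) * integral (cubeQ R) f"

definition ap_mean :: "(real^'d \<Rightarrow> real) \<Rightarrow> real" where
  "ap_mean f = Lim at_top (\<lambda>R. cube_avg R f)"

lemma ap_inner_eq_mean: "ap_inner f g = ap_mean (\<lambda>r. f r * g r)"
  by (simp add: ap_inner_def ap_mean_def cube_avg_def)

lemma mem_cubeQ: "x \<in> cubeQ R \<longleftrightarrow> (\<forall>i. \<bar>x $ i\<bar> \<le> R)"
  by (auto simp: cubeQ_def mem_box_cart abs_le_iff minus_le_iff)

lemma measure_cubeQ:
  assumes "R \<ge> 0"
  shows "measure lebesgue (cubeQ R :: (real^'d) set) = (2 * R) ^ CARD('d)"
proof -
  have "cubeQ R \<noteq> ({} :: (real^'d) set)"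
    using assms by (auto simp: cubeQ_def interval_ne_empty_cart)
  then show ?thesis by (simp add: cubeQ_def content_cbox_cart)
qed

lemma cube_avg_lincomb:
  fixes f g :: "real^'d \<Rightarrow> real"
  assumes "continuous_on UNIV f" "continuous_on UNIV g"
  shows "cube_avg R (\<lambda>r. a * f r + b * g r) = a * cube_avg R f + b * cube_avg R g"
proof -
  have "f integrable_on cubeQ R" "g integrable_on cubeQ R"
    unfolding cubeQ_def using assms by (auto intro!: integrable_continuous intro: continuous_on_subset)
  then have "integral (cubeQ R) (\<lambda>r. a * f r + b * g r)
      = a * integral (cubeQ R) f + b * integral (cubeQ R) g"
    by (intro integral_unique has_integral_add has_integral_mult_right integrable_integral)
  then show ?thesis
    by (simp add: cube_avg_def add_divide_distrib)
qed

lemma cube_avg_abs_le: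
  fixes f :: "real^'d \<Rightarrow> real"
  assumes R: "R > 0" and f: "continuous_on UNIV f" and B: "\<And>r. \<bar>f r\<bar> \<le> B"
  shows "\<bar>cube_avg R f\<bar> \<le> B"
proof -
  have "B \<ge> 0" using B[of 0] by linarith
  moreover have "(f has_integral integral (cubeQ R) f) (cubeQ R)"
    unfolding cubeQ_def by (intro integrable_integral integrable_continuous continuous_on_subset[OF f]) auto
  ultimately have "norm (integral (cubeQ R) f) \<le> B * measure lebesgue (cubeQ R :: (real^'d) set)"
    using has_integral_bound[of B f _ "\<chi> i. - R" "\<chi> i. R"] B by (simp add: cubeQ_def)
  moreover have "measure lebesgue (cubeQ R :: (real^'d) set) > 0" using R by (simp add: measure_cubeQ)
  ultimately show ?thesis by (simp add: cube_avg_def abs_mult field_simps)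
qed

lemma cube_avg_diff_le:
  fixes f g :: "real^'d \<Rightarrow> real"
  assumes "R > 0" "continuous_on UNIV f" "continuous_on UNIV g" "\<And>r. \<bar>f r - g r\<bar> \<le> \<epsilon>"
  shows "\<bar>cube_avg R f - cube_avg R g\<bar> \<le> \<epsilon>"
proof -
  have "\<bar>cube_avg R (\<lambda>r. 1 * f r + (-1) * g r)\<bar> \<le> \<epsilon>"
    using assms by (intro cube_avg_abs_le continuous_intros) auto
  then show ?thesis using cube_avg_lincomb[OF assms(2,3), of R 1 "-1"] by simp
qed

text \<open>
  Monotonicity in the domain, applied to the nonnegative functions \<open>B - f\<close> and \<open>B + f\<close>; this avoids
  integrating over the difference of the boxes.
\<close>

lemma integral_cbox_subset_diff_le:
  fixes f :: "'a::euclidean_space \<Rightarrow> real"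
  assumes f: "continuous_on UNIV f" and B: "\<And>r. \<bar>f r\<bar> \<le> B"
    and sub: "cbox a b \<subseteq> cbox c d"
  shows "\<bar>integral (cbox c d) f - integral (cbox a b) f\<bar> \<le> B * (measure lborel (cbox c d) - measure lborel (cbox a b))"
proof -
  have int: "f integrable_on cbox u v" for u v
    by (intro integrable_continuous continuous_on_subset[OF f]) simp
  have c: "(\<lambda>x. B) integrable_on cbox u v" for u v :: 'a by (rule integrable_const)
  have "integral (cbox a b) (\<lambda>x. B - f x) \<le> integral (cbox c d) (\<lambda>x. B - f x)"
    using B by (intro integral_subset_le sub integrable_diff int c) (smt (verit))
  moreover have "integral (cbox a b) (\<lambda>x. B + f x) \<le> integral (cbox c d) (\<lambda>x. B + f x)"
    using B by (intro integral_subset_le sub integrable_add int c) (smt (verit))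
  ultimately show ?thesis
    by (simp add: integral_diff integral_add int c algebra_simps abs_le_iff)
qed

text \<open>
  The cube of half side \<open>R - K\<close> lies in both the original and the translated cube of half side \<open>R\<close>,
  so both integrals differ from the integral over the smaller cube by the volume of the remaining
  layer times the bound. The layer has relative volume \<open>1 - (1 - K / R)\<^sup>d\<close>, which tends to zero as \<open>R\<close>
  grows.
\<close>

lemma cube_avg_shift_le:
  fixes f :: "real^'d \<Rightarrow> real"
  assumes f: "continuous_on UNIV f" and B: "\<And>r. \<bar>f r\<bar> \<le> B"
    and K: "\<And>i. \<bar>a $ i\<bar> \<le> K" "K \<le> R" "R > 0"
  shows "\<bar>cube_avg R (\<lambda>r. f (r + a)) - cube_avg R f\<bar> \<le> 2 * B * (1 - (1 - K / R) ^ CARD('d))"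
proof -
  let ?u = "\<chi> i. - R :: real^'d" and ?v = "\<chi> i. R :: real^'d"
  let ?V = "measure lebesgue (cubeQ R :: (real^'d) set)"
  let ?s = "integral (cubeQ (R - K)) f"
  have V: "?V = (2 * R) ^ CARD('d)" "?V > 0" using K(3) by (simp_all add: measure_cubeQ)
  have Vs: "measure lebesgue (cubeQ (R - K) :: (real^'d) set) = (2 * (R - K)) ^ CARD('d)"
    using K(2) by (subst measure_cubeQ) auto
  have K0: "K \<ge> 0" using K(1) by (meson abs_ge_zero order_trans)
  have sub: "cubeQ (R - K) \<subseteq> cbox (?u + a) (?v + a)"
  proof
    fix x :: "real^'d" assume x: "x \<in> cubeQ (R - K)"
    show "x \<in> cbox (?u + a) (?v + a)"
      unfolding mem_box_cart
    proof
      fix i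
      have "\<bar>x $ i\<bar> \<le> R - K" using x by (simp add: mem_cubeQ)
      then show "(?u + a) $ i \<le> x $ i \<and> x $ i \<le> (?v + a) $ i" using K(1)[of i] by (simp add: abs_le_iff)
    qed
  qed
  have sub0: "cubeQ (R - K) \<subseteq> (cubeQ R :: (real^'d) set)"
  proof
    fix x :: "real^'d" assume x: "x \<in> cubeQ (R - K)"
    have "\<bar>x $ i\<bar> \<le> R" for i
    proof -
      have "\<bar>x $ i\<bar> \<le> R - K" using x by (simp add: mem_cubeQ)
      then show ?thesis using K0 by linarith
    qed
    then show "x \<in> cubeQ R" by (simp add: mem_cubeQ)
  qed
  have sh: "integral (cubeQ R) (\<lambda>r. f (r + a)) = integral (cbox (?u + a) (?v + a)) f"
    using integral_shift_cbox[of "?u + a" a "?v + a" f] by (simp add: cubeQ_def)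
  have cont: "measure lborel (cbox (?u + a) (?v + a)) = ?V"
    using K(3) by (simp add: content_cbox_cart interval_ne_empty_cart cubeQ_def)
  have "\<bar>integral (cubeQ R) (\<lambda>r. f (r + a)) - ?s\<bar> \<le> B * (?V - (2 * (R - K)) ^ CARD('d))"
    using integral_cbox_subset_diff_le[OF f B sub[unfolded cubeQ_def]] sh Vs cont
    by (simp add: cubeQ_def)
  moreover have "\<bar>integral (cubeQ R) f - ?s\<bar> \<le> B * (?V - (2 * (R - K)) ^ CARD('d))"
    using integral_cbox_subset_diff_le[OF f B sub0[unfolded cubeQ_def]] Vs
    by (simp add: cubeQ_def)
  ultimately have diff: "\<bar>integral (cubeQ R) (\<lambda>r. f (r + a)) - integral (cubeQ R) f\<bar>
      \<le> 2 * B * (?V - (2 * (R - K)) ^ CARD('d))" by linarith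
  have ratio: "(2 * (R - K)) ^ CARD('d) = ?V * (1 - K / R) ^ CARD('d)"
  proof -
    have "2 * (R - K) = 2 * R * (1 - K / R)" using K(3) by (simp add: right_diff_distrib)
    then show ?thesis by (simp only: V power_mult_distrib)
  qed
  have "\<bar>integral (cubeQ R) (\<lambda>r. f (r + a)) - integral (cubeQ R) f\<bar>
      \<le> ?V * (2 * B * (1 - (1 - K / R) ^ CARD('d)))"
    using diff unfolding ratio by (simp add: algebra_simps)
  moreover have "\<bar>cube_avg R (\<lambda>r. f (r + a)) - cube_avg R f\<bar>
      = \<bar>integral (cubeQ R) (\<lambda>r. f (r + a)) - integral (cubeQ R) f\<bar> / ?V"
    using V(2) by (simp add: cube_avg_def diff_divide_distrib[symmetric])
  ultimately show ?thesis using V(2) by (simp add: divide_le_eq mult.commute)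
qed

text \<open>
  For a bounded set of translation vectors this is the preceding estimate. An almost period brings an
  arbitrary vector into a fixed cube at the expense of half of the tolerance.
\<close>

lemma cube_avg_shift_uniform:
  fixes f :: "real^'d \<Rightarrow> real"
  assumes f: "almost_periodic f" and e: "\<epsilon> > 0"
  obtains R0 where "R0 > 0"
    "\<And>R a. R \<ge> R0 \<Longrightarrow> \<bar>cube_avg R (\<lambda>r. f (r + a)) - cube_avg R f\<bar> \<le> \<epsilon>"
proof -
  have e2: "\<epsilon> / 2 > 0" using e by simp
  have cf: "continuous_on UNIV f" by (rule almost_periodic_continuous[OF f])
  have cs: "continuous_on UNIV (\<lambda>r. f (r + a))" for a
    by (rule continuous_on_compose2[OF cf]) (auto intro!: continuous_intros)
  obtain B where B: "B \<ge> 0" "\<And>r. \<bar>f r\<bar> \<le> B"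
    using almost_periodic_bounded[OF f] by (metis real_norm_def)
  obtain L where L: "L > 0"
    "\<And>a. \<exists>b\<in>cbox 0 (\<chi> i. L). \<forall>r. norm (f (r + a) - f (r + b)) < \<epsilon> / 2"
    using almost_periodic_translate_into_cube[OF f e2] by blast
  have "((\<lambda>R. 2 * B * (1 - (1 - L / R) ^ CARD('d))) \<longlongrightarrow> 2 * B * (1 - (1 - 0) ^ CARD('d))) at_top"
    by (intro tendsto_intros tendsto_divide_0[OF tendsto_const] filterlim_at_top_imp_at_infinity filterlim_ident)
  then have "\<forall>\<^sub>F R in at_top. 2 * B * (1 - (1 - L / R) ^ CARD('d)) < \<epsilon> / 2"
    using e2 by (intro order_tendstoD(2)) auto
  then obtain R1 where R1: "\<And>R. R \<ge> R1 \<Longrightarrow> 2 * B * (1 - (1 - L / R) ^ CARD('d)) < \<epsilon> / 2"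
    unfolding eventually_at_top_linorder by blast
  show thesis
  proof (rule that[of "max R1 L"])
    show "max R1 L > 0" using L by simp
    fix R a assume R: "R \<ge> max R1 L"
    obtain b where b: "b \<in> cbox 0 (\<chi> i. L)" "\<And>r. norm (f (r + a) - f (r + b)) < \<epsilon> / 2"
      using L(2) by blast
    have R0: "R > 0" using R L by simp
    have "\<bar>cube_avg R (\<lambda>r. f (r + a)) - cube_avg R (\<lambda>r. f (r + b))\<bar> \<le> \<epsilon> / 2"
      using b(2) by (intro cube_avg_diff_le R0 cs) (auto intro: less_imp_le)
    moreover have "\<bar>cube_avg R (\<lambda>r. f (r + b)) - cube_avg R f\<bar> \<le> 2 * B * (1 - (1 - L / R) ^ CARD('d))"
      using b(1) R R0 by (intro cube_avg_shift_le cf B) (auto simp: mem_box_cart)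
    moreover have "2 * B * (1 - (1 - L / R) ^ CARD('d)) < \<epsilon> / 2" using R1 R by simp
    ultimately show "\<bar>cube_avg R (\<lambda>r. f (r + a)) - cube_avg R f\<bar> \<le> \<epsilon>" by linarith
  qed
qed

lemma cube_avg_swap:
  fixes f :: "real^'d \<Rightarrow> real"
  assumes f: "continuous_on UNIV f"
  shows "cube_avg R (\<lambda>a. cube_avg S (\<lambda>r. f (r + a))) = cube_avg S (\<lambda>r. cube_avg R (\<lambda>a. f (a + r)))"
proof -
  have "continuous_on UNIV (\<lambda>(x, y). f (y + x))"
    unfolding case_prod_beta
    by (rule continuous_on_compose2[OF f]) (auto intro!: continuous_intros)
  then have "integral (cubeQ R) (\<lambda>a. integral (cubeQ S) (\<lambda>r. f (r + a)))
      = integral (cubeQ S) (\<lambda>r. integral (cubeQ R) (\<lambda>a. f (r + a)))"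
    unfolding cubeQ_def by (intro integral_swap_continuous) (auto intro: continuous_on_subset)
  then show ?thesis by (simp add: cube_avg_def add.commute)
qed

lemma continuous_on_cube_avg_shift:
  fixes f :: "real^'d \<Rightarrow> real"
  assumes f: "continuous_on UNIV f"
  shows "continuous_on UNIV (\<lambda>a. cube_avg R (\<lambda>r. f (r + a)))"
proof -
  have "continuous_on UNIV (\<lambda>(x, y). f (y + x))"
    unfolding case_prod_beta
    by (rule continuous_on_compose2[OF f]) (auto intro!: continuous_intros)
  then have "continuous_on UNIV (\<lambda>a. integral (cubeQ R) (\<lambda>r. f (r + a)))"
    unfolding cubeQ_def by (intro integral_continuous_on_param) (auto intro: continuous_on_subset)
  then show ?thesis unfolding cube_avg_def by (intro continuous_intros)
qed

lemma cube_avg_const: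
  assumes "R > 0"
  shows "cube_avg R (\<lambda>r::real^'d. c) = c"
proof -
  have "measure lebesgue (cubeQ R :: (real^'d) set) > 0" using assms by (simp add: measure_cubeQ)
  then show ?thesis by (simp add: cube_avg_def) (simp add: cubeQ_def)
qed

text \<open>
  By the uniform estimate for translates, the double average over the cubes of sizes \<open>R\<close> and \<open>S\<close> is
  close to the average over the cube of size \<open>S\<close>. Exchanging the order of integration, it is
  equally close to the one over the cube of size \<open>R\<close>.
\<close>

lemma cube_avg_Cauchy:
  fixes f :: "real^'d \<Rightarrow> real"
  assumes f: "almost_periodic f" and e: "\<epsilon> > 0"
  obtains R0 where "R0 > 0"
    "\<And>R S. R \<ge> R0 \<Longrightarrow> S \<ge> R0 \<Longrightarrow> \<bar>cube_avg R f - cube_avg S f\<bar> \<le> \<epsilon>"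
proof -
  have cf: "continuous_on UNIV f" by (rule almost_periodic_continuous[OF f])
  obtain R0 where R0: "R0 > 0"
    "\<And>R a. R \<ge> R0 \<Longrightarrow> \<bar>cube_avg R (\<lambda>r. f (r + a)) - cube_avg R f\<bar> \<le> \<epsilon> / 2"
    using cube_avg_shift_uniform[OF f, of "\<epsilon> / 2"] e by auto
  have half: "\<bar>cube_avg R (\<lambda>a. cube_avg S (\<lambda>r. f (r + a))) - cube_avg S f\<bar> \<le> \<epsilon> / 2"
    if "R \<ge> R0" "S \<ge> R0" for R S
  proof -
    have R: "R > 0" using that R0(1) by simp
    have "\<bar>cube_avg R (\<lambda>a. cube_avg S (\<lambda>r. f (r + a))) - cube_avg R (\<lambda>a::real^'d. cube_avg S f)\<bar> \<le> \<epsilon> / 2"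
      by (intro cube_avg_diff_le R continuous_on_cube_avg_shift cf continuous_on_const R0(2) that)
    then show ?thesis using R by (simp add: cube_avg_const)
  qed
  show thesis
  proof (rule that[OF R0(1)])
    fix R S assume "R \<ge> R0" "S \<ge> R0"
    then show "\<bar>cube_avg R f - cube_avg S f\<bar> \<le> \<epsilon>"
      using half[of R S] half[of S R] cube_avg_swap[OF cf, of R S] by linarith
  qed
qed

lemma ap_mean_eqI:
  "((\<lambda>R. cube_avg R f) \<longlongrightarrow> L) at_top \<Longrightarrow> ap_mean f = L"
  unfolding ap_mean_def by (rule tendsto_Lim[OF trivial_limit_at_top_linorder])

text \<open>
  The existence of the mean value. The limit is found along the natural numbers, where completeness
  applies directly, and the Cauchy estimate carries it over to real side lengths.
\<close>

lemma cube_avg_tendsto_mean: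
  fixes f :: "real^'d \<Rightarrow> real"
  assumes f: "almost_periodic f"
  shows "((\<lambda>R. cube_avg R f) \<longlongrightarrow> ap_mean f) at_top"
proof -
  let ?X = "\<lambda>n. cube_avg (real n) f"
  have "Cauchy ?X"
    unfolding Cauchy_altdef2
  proof (intro allI impI)
    fix e :: real assume "e > 0"
    then have e2: "e / 2 > 0" by simp
    obtain R0 where
      R0: "\<And>R S. R \<ge> R0 \<Longrightarrow> S \<ge> R0 \<Longrightarrow> \<bar>cube_avg R f - cube_avg S f\<bar> \<le> e / 2"
      by (rule cube_avg_Cauchy[OF f e2]) blast
    obtain N where "real N \<ge> R0" using real_arch_simple by blast
    have "dist (?X n) (?X N) < e" if "n \<ge> N" for n
    proof -
      have "real n \<ge> real N" using that by simp
      then have "\<bar>?X n - ?X N\<bar> \<le> e / 2" using \<open>real N \<ge> R0\<close> by (intro R0) auto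
      then show ?thesis using \<open>e > 0\<close> by (simp add: dist_real_def)
    qed
    then show "\<exists>N. \<forall>n\<ge>N. dist (?X n) (?X N) < e" by blast
  qed
  then obtain L where L: "?X \<longlonglongrightarrow> L" using Cauchy_convergent convergent_def by blast
  have "((\<lambda>R. cube_avg R f) \<longlongrightarrow> L) at_top"
    unfolding tendsto_iff
  proof (intro allI impI)
    fix e :: real assume e: "e > 0"
    then have e2: "e / 2 > 0" by simp
    obtain R0 where
      R0: "\<And>R S. R \<ge> R0 \<Longrightarrow> S \<ge> R0 \<Longrightarrow> \<bar>cube_avg R f - cube_avg S f\<bar> \<le> e / 2"
      by (rule cube_avg_Cauchy[OF f e2]) blast
    have "dist (cube_avg R f) L < e" if R: "R \<ge> R0" for R
    proof -
      have "(\<lambda>n. \<bar>cube_avg R f - ?X n\<bar>) \<longlonglongrightarrow> \<bar>cube_avg R f - L\<bar>" by (rule tendsto_rabs[OF tendsto_diff[OF tendsto_const L]])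
      moreover have "\<forall>\<^sub>F n in sequentially. \<bar>cube_avg R f - ?X n\<bar> \<le> e / 2"
        using eventually_ge_at_top[of "nat \<lceil>R0\<rceil>"]
      proof eventually_elim
        case (elim n)
        then have "R0 \<le> real n" by linarith
        with R show ?case by (rule R0)
      qed
      ultimately have "\<bar>cube_avg R f - L\<bar> \<le> e / 2"
        by (rule tendsto_upperbound) simp
      then show ?thesis using e by (simp add: dist_real_def)
    qed
    then show "\<forall>\<^sub>F R in at_top. dist (cube_avg R f) L < e"
      unfolding eventually_at_top_linorder by blast
  qed
  moreover from this have "ap_mean f = L" by (rule ap_mean_eqI)
  ultimately show ?thesis by simp
qed

lemma ap_mean_lincomb:
  fixes f g :: "real^'d \<Rightarrow> real"
  assumes "almost_periodic f" "almost_periodic g"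
  shows "ap_mean (\<lambda>r. a * f r + b * g r) = a * ap_mean f + b * ap_mean g"
proof (rule ap_mean_eqI)
  show "((\<lambda>R. cube_avg R (\<lambda>r. a * f r + b * g r)) \<longlongrightarrow> a * ap_mean f + b * ap_mean g) at_top"
    unfolding cube_avg_lincomb[OF almost_periodic_continuous[OF assms(1)] almost_periodic_continuous[OF assms(2)]]
    by (intro tendsto_intros cube_avg_tendsto_mean assms)
qed

lemma ap_mean_add:
  fixes f g :: "real^'d \<Rightarrow> real"
  shows "almost_periodic f \<Longrightarrow> almost_periodic g \<Longrightarrow> ap_mean (\<lambda>r. f r + g r) = ap_mean f + ap_mean g"
  using ap_mean_lincomb[of f g 1 1] by simp

lemma ap_mean_cmult:
  fixes f :: "real^'d \<Rightarrow> real"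
  shows "almost_periodic f \<Longrightarrow> ap_mean (\<lambda>r. c * f r) = c * ap_mean f"
  using ap_mean_lincomb[of f f c 0] by simp

lemma ap_mean_sum:
  fixes f :: "'i \<Rightarrow> real^'d \<Rightarrow> real"
  assumes "\<And>i. i \<in> A \<Longrightarrow> almost_periodic (f i)"
  shows "ap_mean (\<lambda>r. \<Sum>i\<in>A. f i r) = (\<Sum>i\<in>A. ap_mean (f i))"
proof -
  have zero: "ap_mean (\<lambda>r::real^'d. 0) = 0"
    by (intro ap_mean_eqI) (simp add: cube_avg_def)
  show ?thesis using assms
    by (induction A rule: infinite_finite_induct)
      (auto simp: zero ap_mean_add almost_periodic_sum)
qed

lemma ap_mean_nonneg:
  fixes f :: "real^'d \<Rightarrow> real"
  assumes f: "almost_periodic f" and nn: "\<And>r. f r \<ge> 0"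
  shows "ap_mean f \<ge> 0"
proof (rule tendsto_lowerbound[OF cube_avg_tendsto_mean[OF f]])
  have "cube_avg R f \<ge> 0" for R
    using nn by (auto simp: cube_avg_def intro!: integral_nonneg divide_nonneg_nonneg integrable_continuous almost_periodic_continuous[OF f] simp: cubeQ_def)
  then show "\<forall>\<^sub>F R in at_top. 0 \<le> cube_avg R f" by simp
qed simp

section \<open>Integration by parts\<close>

text \<open>
  Differentiability makes \<open>partial_deriv\<close>, which is defined at the parameter zero, the derivative along
  the whole coordinate line.
\<close>

lemma has_partial_deriv:
  fixes f :: "real^'d \<Rightarrow> real"
  assumes f: "\<And>x. f differentiable (at x)"
  shows "((\<lambda>s. f (x + s *\<^sub>R axis i 1)) has_real_derivative partial_deriv i f (x + t *\<^sub>R axis i 1)) (at t)"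
proof -
  have at0: "((\<lambda>s. f (y + s *\<^sub>R axis i 1)) has_real_derivative partial_deriv i f y) (at 0)" for y
  proof -
    have "f differentiable at (y + 0 *\<^sub>R axis i 1)" by (rule f)
    then obtain D where D: "(f has_derivative D) (at (y + 0 *\<^sub>R axis i 1))"
      unfolding differentiable_def by blast
    have "((\<lambda>s::real. y + s *\<^sub>R axis i 1) has_derivative (\<lambda>s. s *\<^sub>R axis i 1)) (at 0)"
      by (auto intro!: derivative_eq_intros)
    from has_derivative_compose[OF this D]
    have "(\<lambda>s. f (y + s *\<^sub>R axis i 1)) differentiable (at 0)" unfolding differentiable_def by blast
    then show ?thesis
      unfolding partial_deriv_def
      by (metis DERIV_deriv_iff_real_differentiable)
  qed
  have "((\<lambda>s. f (x + (s + t) *\<^sub>R axis i 1)) has_real_derivative partial_deriv i f (x + t *\<^sub>R axis i 1)) (at 0)"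
    using at0[of "x + t *\<^sub>R axis i 1"] by (simp add: algebra_simps)
  then show ?thesis
    using DERIV_shift[of "\<lambda>s. f (x + s *\<^sub>R axis i 1)" _ 0 t] by simp
qed

lemma partial_deriv_eqI:
  "((\<lambda>s. f (x + s *\<^sub>R axis i 1)) has_real_derivative D) (at 0) \<Longrightarrow> partial_deriv i f x = D"
  unfolding partial_deriv_def by (rule DERIV_imp_deriv)

lemma partial_deriv_lincomb:
  fixes f g :: "real^'d \<Rightarrow> real"
  assumes "\<And>x. f differentiable (at x)" "\<And>x. g differentiable (at x)"
  shows "partial_deriv i (\<lambda>x. a * f x + b * g x) = (\<lambda>x. a * partial_deriv i f x + b * partial_deriv i g x)"
proof
  fix x
  show "partial_deriv i (\<lambda>x. a * f x + b * g x) x = a * partial_deriv i f x + b * partial_deriv i g x"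
    using has_partial_deriv[of f x i 0] has_partial_deriv[of g x i 0] assms
    by (intro partial_deriv_eqI) (auto intro!: derivative_eq_intros)
qed

lemma partial_deriv_mult:
  fixes f g :: "real^'d \<Rightarrow> real"
  assumes "\<And>x. f differentiable (at x)" "\<And>x. g differentiable (at x)"
  shows "partial_deriv i (\<lambda>x. f x * g x) = (\<lambda>x. partial_deriv i f x * g x + f x * partial_deriv i g x)"
proof
  fix x
  show "partial_deriv i (\<lambda>x. f x * g x) x = partial_deriv i f x * g x + f x * partial_deriv i g x"
    using has_partial_deriv[of f x i 0] has_partial_deriv[of g x i 0] assms
    by (intro partial_deriv_eqI) (auto intro!: derivative_eq_intros)
qed

lemma partial_deriv_const: "partial_deriv i (\<lambda>x. c) = (\<lambda>x. 0)"
  by (auto simp: partial_deriv_def)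

text \<open>
  By the mean value theorem and the uniform continuity of the derivative, a difference quotient with
  a small fixed step \<open>s\<close> is uniformly close to the derivative. The average of the quotient tends to
  zero because the averages of \<open>h\<close> and its translate agree in the limit.
\<close>

lemma ap_mean_partial_deriv:
  fixes h :: "real^'d \<Rightarrow> real"
  assumes h: "almost_periodic h" and dh: "\<And>x. h differentiable (at x)"
    and ap: "almost_periodic (partial_deriv i h)"
  shows "ap_mean (partial_deriv i h) = 0"
proof -
  let ?p = "partial_deriv i h" and ?e = "axis i 1 :: real^'d"
  have ch: "continuous_on UNIV h" and cp: "continuous_on UNIV ?p"
    by (rule almost_periodic_continuous[OF h], rule almost_periodic_continuous[OF ap])
  have cs: "continuous_on UNIV (\<lambda>r. h (r + a))" for a
    by (rule continuous_on_compose2[OF ch]) (auto intro!: continuous_intros)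
  have "\<bar>ap_mean ?p\<bar> \<le> \<epsilon>" if e: "\<epsilon> > 0" for \<epsilon>
  proof -
    have e2: "\<epsilon> / 2 > 0" using e by simp
    obtain d where d: "d > 0" "\<And>x y. dist y x < d \<Longrightarrow> dist (?p y) (?p x) < \<epsilon> / 2"
      using uniformly_continuous_onE[OF almost_periodic_uniformly_continuous[OF ap] e2] by auto
    define s where "s = d / 2"
    have s: "s > 0" "s < d" using d(1) by (auto simp: s_def)
    have quot: "\<bar>(1 / s * h (r + s *\<^sub>R ?e) + (- 1 / s) * h r) - ?p r\<bar> \<le> \<epsilon> / 2" for r
    proof -
      obtain z where z: "0 < z" "z < s"
        "h (r + s *\<^sub>R ?e) - h (r + 0 *\<^sub>R ?e) = (s - 0) * ?p (r + z *\<^sub>R ?e)"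
        using MVT2[OF s(1), of "\<lambda>s. h (r + s *\<^sub>R ?e)" "\<lambda>t. ?p (r + t *\<^sub>R ?e)"]
          has_partial_deriv[OF dh] by blast
      have "1 / s * h (r + s *\<^sub>R ?e) + (- 1 / s) * h r = ?p (r + z *\<^sub>R ?e)"
        using z(3) s(1) by (simp add: field_simps)
      moreover have "dist (?p (r + z *\<^sub>R ?e)) (?p r) < \<epsilon> / 2"
        using z s by (intro d(2)) (simp add: dist_norm)
      ultimately show ?thesis by (simp add: dist_real_def)
    qed
    obtain R0 where R0: "R0 > 0"
      "\<And>R a. R \<ge> R0 \<Longrightarrow> \<bar>cube_avg R (\<lambda>r. h (r + a)) - cube_avg R h\<bar> \<le> s * (\<epsilon> / 2)"
      using cube_avg_shift_uniform[OF h, of "s * (\<epsilon> / 2)"] s(1) e2 by (metis mult_pos_pos)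
    have "\<bar>cube_avg R ?p\<bar> \<le> \<epsilon>" if R: "R \<ge> R0" for R
    proof -
      have "\<bar>cube_avg R (\<lambda>r. 1 / s * h (r + s *\<^sub>R ?e) + (- 1 / s) * h r) - cube_avg R ?p\<bar> \<le> \<epsilon> / 2"
        using R R0(1) by (intro cube_avg_diff_le quot cp continuous_intros cs ch) auto
      moreover have "cube_avg R (\<lambda>r. 1 / s * h (r + s *\<^sub>R ?e) + (- 1 / s) * h r)
          = (cube_avg R (\<lambda>r. h (r + s *\<^sub>R ?e)) - cube_avg R h) / s"
        by (subst cube_avg_lincomb[OF cs ch]) (simp add: diff_divide_distrib)
      moreover have "\<bar>(cube_avg R (\<lambda>r. h (r + s *\<^sub>R ?e)) - cube_avg R h) / s\<bar> \<le> \<epsilon> / 2"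
        using R0(2)[OF R, of "s *\<^sub>R ?e"] s(1) by (simp add: divide_le_eq mult.commute)
      ultimately show ?thesis by linarith
    qed
    then have "\<forall>\<^sub>F R in at_top. \<bar>cube_avg R ?p\<bar> \<le> \<epsilon>"
      unfolding eventually_at_top_linorder by blast
    then show ?thesis
      using tendsto_upperbound[OF tendsto_rabs[OF cube_avg_tendsto_mean[OF ap]]] by simp
  qed
  then have "\<bar>ap_mean ?p\<bar> \<le> 0" by (rule field_le_epsilon) simp
  then show ?thesis by simp
qed

lemma ap_smooth_almost_periodic: "ap_smooth k f \<Longrightarrow> almost_periodic f"
  by (cases k) auto

lemma ap_smooth_SucD: "ap_smooth (Suc k) f \<Longrightarrow> ap_smooth k f"
  by (induction k arbitrary: f) auto

lemma ap_smooth_mono: "ap_smooth k f \<Longrightarrow> l \<le> k \<Longrightarrow> ap_smooth l f"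
  by (induction k) (auto simp: le_Suc_eq dest: ap_smooth_SucD simp del: ap_smooth.simps)

lemma ap_smooth_lincomb:
  fixes f g :: "real^'d \<Rightarrow> real"
  shows "ap_smooth k f \<Longrightarrow> ap_smooth k g \<Longrightarrow> ap_smooth k (\<lambda>x. a * f x + b * g x)"
proof (induction k arbitrary: f g)
  case 0
  then show ?case by (simp add: almost_periodic_lincomb)
next
  case (Suc k)
  then have d: "f differentiable (at x)" "g differentiable (at x)" for x by auto
  show ?case
    using Suc by (auto simp: almost_periodic_lincomb partial_deriv_lincomb d)
qed

lemma ap_smooth_const: "ap_smooth k (\<lambda>x. c)"
  by (induction k arbitrary: c) (auto simp: almost_periodic_const partial_deriv_const)

lemma ap_smooth_add:
  fixes f g :: "real^'d \<Rightarrow> real"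
  shows "ap_smooth k f \<Longrightarrow> ap_smooth k g \<Longrightarrow> ap_smooth k (\<lambda>x. f x + g x)"
  using ap_smooth_lincomb[of k f g 1 1] by simp

lemma ap_smooth_sum:
  fixes f :: "'i \<Rightarrow> real^'d \<Rightarrow> real"
  assumes "\<And>i. i \<in> A \<Longrightarrow> ap_smooth k (f i)"
  shows "ap_smooth k (\<lambda>r. \<Sum>i\<in>A. f i r)"
  using assms
  by (induction A rule: infinite_finite_induct) (auto intro: ap_smooth_const ap_smooth_add)

text \<open>
  Integration by parts: the mean of the derivative of the product vanishes.
\<close>

lemma ap_inner_partial_deriv:
  fixes u v :: "real^'d \<Rightarrow> real"
  assumes u: "ap_smooth (Suc 0) u" and v: "ap_smooth (Suc 0) v"
  shows "ap_inner (partial_deriv i u) v = - ap_inner u (partial_deriv i v)"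
proof -
  have d: "\<And>x. u differentiable (at x)" "\<And>x. v differentiable (at x)" using u v by auto
  have ap: "almost_periodic u" "almost_periodic v"
    "almost_periodic (partial_deriv i u)" "almost_periodic (partial_deriv i v)" using u v by auto
  have "ap_mean (partial_deriv i (\<lambda>x. u x * v x)) = 0"
    using ap by (intro ap_mean_partial_deriv)
      (auto simp: partial_deriv_mult d intro!: almost_periodic_mult almost_periodic_add differentiable_mult)
  then have "ap_mean (\<lambda>r. partial_deriv i u r * v r) + ap_mean (\<lambda>r. u r * partial_deriv i v r) = 0"
    using ap by (simp add: partial_deriv_mult d ap_mean_add almost_periodic_mult)
  then show ?thesis by (simp add: ap_inner_eq_mean)
qed

lemma ap_inner_laplacian:
  fixes u v :: "real^'d \<Rightarrow> real"
  assumes u: "ap_smooth (Suc (Suc 0)) u" and v: "ap_smooth (Suc (Suc 0)) v"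
  shows "ap_inner (laplacian u) v = ap_inner u (laplacian v)"
proof -
  have ap: "almost_periodic u" "almost_periodic v"
    "almost_periodic (partial_deriv i (partial_deriv i u))"
    "almost_periodic (partial_deriv i (partial_deriv i v))" for i using u v by auto
  have s: "ap_smooth (Suc 0) u" "ap_smooth (Suc 0) v"
    "ap_smooth (Suc 0) (partial_deriv i u)" "ap_smooth (Suc 0) (partial_deriv i v)" for i
    using u v by auto
  have "ap_inner (laplacian u) v = (\<Sum>i\<in>UNIV. ap_inner (partial_deriv i (partial_deriv i u)) v)"
    by (simp add: ap_inner_eq_mean laplacian_def sum_distrib_right ap_mean_sum almost_periodic_mult ap)
  also have "\<dots> = (\<Sum>i\<in>UNIV. ap_inner u (partial_deriv i (partial_deriv i v)))"
    using s by (simp only: ap_inner_partial_deriv minus_minus)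
  also have "\<dots> = ap_inner u (laplacian v)"
    by (simp add: ap_inner_eq_mean laplacian_def sum_distrib_left ap_mean_sum almost_periodic_mult ap)
  finally show ?thesis .
qed

section \<open>The operator \<open>\<G>\<close>\<close>

text \<open>One factor \<open>\<Delta> + c\<close> of \<open>\<G>\<close>; in the application \<open>c\<close> is a squared length-scale.\<close>

definition helmholtz :: "real \<Rightarrow> (real^'d \<Rightarrow> real) \<Rightarrow> real^'d \<Rightarrow> real" where
  "helmholtz c f = (\<lambda>x. laplacian f x + c * f x)"

lemma opG_Suc_helmholtz: "opG q (Suc m) f = helmholtz ((q (Suc m))\<^sup>2) (opG q m f)"
  by (simp add: helmholtz_def)

lemma laplacian_lincomb:
  fixes f g :: "real^'d \<Rightarrow> real"
  assumes f: "ap_smooth (Suc (Suc 0)) f" and g: "ap_smooth (Suc (Suc 0)) g"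
  shows "laplacian (\<lambda>x. a * f x + b * g x) = (\<lambda>x. a * laplacian f x + b * laplacian g x)"
proof -
  have d: "f differentiable (at x)" "g differentiable (at x)"
    "partial_deriv i f differentiable (at x)" "partial_deriv i g differentiable (at x)" for x i
    using f g by auto
  show ?thesis
    unfolding laplacian_def
    by (simp add: partial_deriv_lincomb d sum.distrib sum_distrib_left)
qed

lemma ap_smooth_laplacian:
  "ap_smooth (Suc (Suc k)) f \<Longrightarrow> ap_smooth k (laplacian f)"
  unfolding laplacian_def by (intro ap_smooth_sum) simp

lemma ap_smooth_helmholtz:
  assumes "ap_smooth (Suc (Suc k)) f"
  shows "ap_smooth k (helmholtz c f)"
  using ap_smooth_lincomb[OF ap_smooth_laplacian[OF assms] ap_smooth_SucD[OF ap_smooth_SucD[OF assms]], of 1 c]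
  by (simp add: helmholtz_def)

lemma helmholtz_lincomb:
  fixes f g :: "real^'d \<Rightarrow> real"
  assumes "ap_smooth (Suc (Suc 0)) f" "ap_smooth (Suc (Suc 0)) g"
  shows "helmholtz c (\<lambda>x. a * f x + b * g x) = (\<lambda>x. a * helmholtz c f x + b * helmholtz c g x)"
  by (simp add: helmholtz_def laplacian_lincomb[OF assms] algebra_simps)

text \<open>
  Both sides expand to \<open>\<Delta>\<^sup>2 f + (a + b) \<Delta> f + a b f\<close> by the linearity of the Laplacian.
\<close>

lemma helmholtz_commute:
  fixes f :: "real^'d \<Rightarrow> real"
  assumes f: "ap_smooth (Suc (Suc (Suc (Suc 0)))) f"
  shows "helmholtz a (helmholtz b f) = helmholtz b (helmholtz a f)"
proof -
  have s: "ap_smooth (Suc (Suc 0)) (laplacian f)" "ap_smooth (Suc (Suc 0)) f"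
    using f by (auto intro: ap_smooth_laplacian ap_smooth_SucD simp del: ap_smooth.simps)
  have "laplacian (helmholtz c f) = (\<lambda>x. laplacian (laplacian f) x + c * laplacian f x)" for c
    using laplacian_lincomb[OF s, of 1 c] by (simp add: helmholtz_def)
  then show ?thesis
    by (auto simp: helmholtz_def[of _ "helmholtz _ _"]) (simp add: helmholtz_def algebra_simps)
qed

lemma ap_inner_helmholtz:
  fixes u v :: "real^'d \<Rightarrow> real"
  assumes u: "ap_smooth (Suc (Suc 0)) u" and v: "ap_smooth (Suc (Suc 0)) v"
  shows "ap_inner (helmholtz c u) v = ap_inner u (helmholtz c v)"
proof -
  have ap: "almost_periodic u" "almost_periodic v"
    "almost_periodic (laplacian u)" "almost_periodic (laplacian v)"
    using u v ap_smooth_laplacian[of 0] by (auto intro: ap_smooth_almost_periodic)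
  have "ap_inner (helmholtz c u) v = ap_mean (\<lambda>r. laplacian u r * v r) + ap_mean (\<lambda>r. c * (u r * v r))"
    by (subst ap_mean_add[symmetric])
      (auto simp: ap_inner_eq_mean helmholtz_def algebra_simps intro!: almost_periodic_mult almost_periodic_cmult ap)
  also have "\<dots> = ap_mean (\<lambda>r. u r * laplacian v r) + ap_mean (\<lambda>r. c * (u r * v r))"
    using ap_inner_laplacian[OF u v] by (simp add: ap_inner_eq_mean)
  also have "\<dots> = ap_inner u (helmholtz c v)"
    by (subst ap_mean_add[symmetric])
      (auto simp: ap_inner_eq_mean helmholtz_def algebra_simps intro!: almost_periodic_mult almost_periodic_cmult ap)
  finally show ?thesis .
qed

lemma ap_smooth_opG: "ap_smooth (k + 2 * m) f \<Longrightarrow> ap_smooth k (opG q m f)"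
proof (induction m arbitrary: k)
  case (Suc m)
  have "ap_smooth (Suc (Suc k)) (opG q m f)" using Suc by (intro Suc.IH) simp
  then show ?case unfolding opG_Suc_helmholtz by (rule ap_smooth_helmholtz)
qed simp

lemma opG_lincomb:
  fixes f g :: "real^'d \<Rightarrow> real"
  shows "ap_smooth (2 * m) f \<Longrightarrow> ap_smooth (2 * m) g \<Longrightarrow>
    opG q m (\<lambda>x. a * f x + b * g x) = (\<lambda>x. a * opG q m f x + b * opG q m g x)"
proof (induction m)
  case (Suc m)
  have s: "ap_smooth (Suc (Suc 0)) (opG q m f)" "ap_smooth (Suc (Suc 0)) (opG q m g)"
    using Suc.prems by (auto intro!: ap_smooth_opG simp del: ap_smooth.simps)
  have "ap_smooth (2 * m) f" "ap_smooth (2 * m) g"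
    using Suc.prems by (auto elim: ap_smooth_mono simp del: ap_smooth.simps)
  then show ?case
    unfolding opG_Suc_helmholtz by (simp add: Suc.IH helmholtz_lincomb[OF s])
qed simp

text \<open>
  \<open>opG\<close> adds new factors on the left, whereas the induction for its symmetry produces one on the right.
\<close>

lemma opG_helmholtz_commute:
  fixes f :: "real^'d \<Rightarrow> real"
  shows "ap_smooth (Suc (Suc (2 * m))) f \<Longrightarrow> opG q m (helmholtz c f) = helmholtz c (opG q m f)"
proof (induction m)
  case (Suc m)
  have s: "ap_smooth (Suc (Suc (Suc (Suc 0)))) (opG q m f)"
    using Suc.prems by (intro ap_smooth_opG) (simp del: ap_smooth.simps)
  have "ap_smooth (Suc (Suc (2 * m))) f"
    using Suc.prems by (rule ap_smooth_mono) simp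
  then show ?case
    unfolding opG_Suc_helmholtz by (simp add: Suc.IH helmholtz_commute[OF s])
qed simp

text \<open>
  Moving the factors of \<open>\<G>\<close> to the other side one at a time reverses their order. They commute, so the
  result is \<open>\<G>\<close> again.
\<close>

lemma ap_inner_opG:
  fixes u v :: "real^'d \<Rightarrow> real"
  shows "ap_smooth (2 * m) u \<Longrightarrow> ap_smooth (2 * m) v \<Longrightarrow> ap_inner (opG q m u) v = ap_inner u (opG q m v)"
proof (induction m arbitrary: u v)
  case (Suc m)
  let ?c = "(q (Suc m))\<^sup>2"
  have s: "ap_smooth (Suc (Suc (2 * m))) u" "ap_smooth (Suc (Suc (2 * m))) v"
    using Suc.prems by (simp_all del: ap_smooth.simps)
  have s2: "ap_smooth (2 * m) u" "ap_smooth (Suc (Suc 0)) v"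
    using s by (auto elim: ap_smooth_mono simp del: ap_smooth.simps)
  have "ap_inner (opG q (Suc m) u) v = ap_inner (opG q m u) (helmholtz ?c v)"
    unfolding opG_Suc_helmholtz
    using s by (intro ap_inner_helmholtz s2 ap_smooth_opG) (simp del: ap_smooth.simps)
  also have "\<dots> = ap_inner u (opG q m (helmholtz ?c v))"
    by (intro Suc.IH s2 ap_smooth_helmholtz s)
  also have "\<dots> = ap_inner u (opG q (Suc m) v)"
    by (simp only: opG_Suc_helmholtz opG_helmholtz_commute[OF s(2)])
  finally show ?case .
qed simp

section \<open>Energy dissipation\<close>

text \<open>
  The square root in the norm is harmless because the mean of a square is nonnegative.
\<close>

lemma ap_norm_squared:
  fixes f :: "real^'d \<Rightarrow> real"
  assumes "almost_periodic f"
  shows "(ap_norm f)\<^sup>2 = ap_inner f f"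
  using ap_mean_nonneg[OF almost_periodic_mult[OF assms assms]]
  by (simp add: ap_norm_def ap_inner_eq_mean)

text \<open>
  The identity \<open>(a\<^sup>2 - b\<^sup>2) / 2 = (a + b) / 2 * (a - b)\<close> for \<open>a = \<G> u\<close> and \<open>b = \<G> v\<close>, after which
  one \<open>\<G>\<close> is moved from the difference to the midpoint.
\<close>

lemma half_norm_difference_opG:
  fixes u v :: "real^'d \<Rightarrow> real"
  assumes u: "ap_smooth (4 * m) u" and v: "ap_smooth (4 * m) v"
  shows "1 / 2 * (ap_norm (opG q m u))\<^sup>2 - 1 / 2 * (ap_norm (opG q m v))\<^sup>2
    = ap_inner (opG q m (opG q m (\<lambda>r. (u r + v r) / 2))) (\<lambda>r. u r - v r)"
proof -
  let ?G = "opG q m :: (real^'d \<Rightarrow> real) \<Rightarrow> _"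
  let ?h = "\<lambda>r. (u r + v r) / 2" and ?d = "\<lambda>r. u r - v r"
  have u2: "ap_smooth (2 * m) u" and v2: "ap_smooth (2 * m) v"
    using u v by (auto elim: ap_smooth_mono)
  have ap: "almost_periodic (?G u)" "almost_periodic (?G v)"
    using ap_smooth_opG[of 0 m] u2 v2 by simp_all
  have heq: "?h = (\<lambda>r. 1 / 2 * u r + 1 / 2 * v r)" and deq: "?d = (\<lambda>r. 1 * u r + (-1) * v r)"
    by (auto simp: field_simps)
  have h: "ap_smooth (4 * m) ?h" unfolding heq by (intro ap_smooth_lincomb u v)
  have d: "ap_smooth (2 * m) ?d" unfolding deq by (intro ap_smooth_lincomb u2 v2)
  have Gh: "?G ?h = (\<lambda>r. 1 / 2 * ?G u r + 1 / 2 * ?G v r)" unfolding heq by (intro opG_lincomb u2 v2)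
  have Gd: "?G ?d = (\<lambda>r. 1 * ?G u r + (-1) * ?G v r)" unfolding deq by (intro opG_lincomb u2 v2)
  have "ap_smooth (2 * m) (?G ?h)" using h by (intro ap_smooth_opG) simp
  then have "ap_inner (?G (?G ?h)) ?d = ap_inner (?G ?h) (?G ?d)" by (intro ap_inner_opG d)
  also have "\<dots> = ap_mean (\<lambda>r. 1 / 2 * (?G u r * ?G u r) + (- 1 / 2) * (?G v r * ?G v r))"
    unfolding Gh Gd ap_inner_eq_mean by (rule arg_cong[of _ _ ap_mean]) (auto simp: field_simps)
  also have "\<dots> = 1 / 2 * ap_inner (?G u) (?G u) + (- 1 / 2) * ap_inner (?G v) (?G v)"
    unfolding ap_inner_eq_mean by (intro ap_mean_lincomb almost_periodic_mult ap)
  finally show ?thesis by (simp add: ap_norm_squared ap)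
qed

lemma almost_periodic_potN':
  fixes f :: "real^'d \<Rightarrow> real"
  assumes "almost_periodic f"
  shows "almost_periodic (\<lambda>r. potN' \<epsilon> \<alpha> (f r))"
  unfolding potN'_def by (rule almost_periodic_compose[OF assms]) (intro continuous_intros)

theorem theorem3p1:
  fixes q :: "nat \<Rightarrow> real" and m :: nat
    and \<epsilon> \<alpha> C1 T :: real and NT :: nat
    and t \<tau> \<R> :: "nat \<Rightarrow> real"
    and \<phi> W :: "nat \<Rightarrow> real^'d \<Rightarrow> real"
  assumes dim: "CARD('d) \<in> {1, 2, 3}"
    and C1: "C1 > 0"
    and partition: "t 0 = 0" "t NT = T" "\<And>n. n < NT \<Longrightarrow> t n < t (n + 1)"
    and step: "\<And>n. \<tau> n = t (n + 1) - t n"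
    and regular: "\<And>n. n \<le> NT \<Longrightarrow> ap_smooth (4 * m) (\<phi> n)"
    and F1_nonneg: "\<And>n. 1 \<le> n \<Longrightarrow> n < NT \<Longrightarrow> F1 \<epsilon> \<alpha> C1 (phi_bar \<phi> n) \<ge> 0"
    and scheme_phi: "\<And>n r. 1 \<le> n \<Longrightarrow> n < NT \<Longrightarrow>
      (\<phi> (n + 1) r - \<phi> n r) / \<tau> n = - W n r"
    and scheme_W: "\<And>n r. 1 \<le> n \<Longrightarrow> n < NT \<Longrightarrow>
      W n r = opG q m (opG q m (phi_half \<phi> n)) r
        + R_half \<R> n / sqrt (F1 \<epsilon> \<alpha> C1 (phi_bar \<phi> n)) * potN' \<epsilon> \<alpha> (phi_bar \<phi> n r)"
    and scheme_R: "\<And>n. 1 \<le> n \<Longrightarrow> n < NT \<Longrightarrow>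
      (\<R> (n + 1) - \<R> n) / \<tau> n =
        ap_inner (\<lambda>r. potN' \<epsilon> \<alpha> (phi_bar \<phi> n r) / (2 * sqrt (F1 \<epsilon> \<alpha> C1 (phi_bar \<phi> n))))
                 (\<lambda>r. (\<phi> (n + 1) r - \<phi> n r) / \<tau> n)"
  shows "\<forall>n. 1 \<le> n \<and> n < NT \<longrightarrow>
    modified_energy q m C1 \<phi> \<R> (n + 1) - modified_energy q m C1 \<phi> \<R> n \<le> 0"
proof (intro allI impI)
  fix n assume "1 \<le> n \<and> n < NT"
  then have n: "1 \<le> n" "n < NT" by auto
  define d where "d = (\<lambda>r. \<phi> (n + 1) r - \<phi> n r)"
  define GG where "GG = opG q m (opG q m (phi_half \<phi> n))"
  define N where "N = (\<lambda>r. potN' \<epsilon> \<alpha> (phi_bar \<phi> n r))"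
  define s where "s = sqrt (F1 \<epsilon> \<alpha> C1 (phi_bar \<phi> n))"
  have tau: "\<tau> n > 0" using partition(3)[OF n(2)] step[of n] by simp
  have reg: "ap_smooth (4 * m) (\<phi> (n + 1))" "ap_smooth (4 * m) (\<phi> n)" "ap_smooth (4 * m) (\<phi> (n - 1))"
    using n by (auto intro!: regular)
  note ap_phi = reg[THEN ap_smooth_almost_periodic]
  have half: "phi_half \<phi> n = (\<lambda>r. (\<phi> (n + 1) r + \<phi> n r) / 2)" by (auto simp: phi_half_def)
  have bar: "phi_bar \<phi> n = (\<lambda>r. 3 / 2 * \<phi> n r + (- 1 / 2) * \<phi> (n - 1) r)"
    by (auto simp: phi_bar_def field_simps)
  have ap_d: "almost_periodic d" unfolding d_def by (intro almost_periodic_diff ap_phi)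
  have ap_N: "almost_periodic N"
    unfolding N_def bar by (intro almost_periodic_potN' almost_periodic_lincomb ap_phi)
  have "ap_smooth (4 * m) (phi_half \<phi> n)"
    using ap_smooth_lincomb[OF reg(1,2), of "1 / 2" "1 / 2"] by (simp add: half field_simps)
  then have "ap_smooth 0 GG"
    unfolding GG_def by (intro ap_smooth_opG) simp
  then have ap_GG: "almost_periodic GG" by simp
  have ap_GGd: "almost_periodic (\<lambda>r. GG r * d r)" and ap_Nd: "almost_periodic (\<lambda>r. N r * d r)"
    and ap_dd: "almost_periodic (\<lambda>r. d r * d r)"
    by (intro almost_periodic_mult ap_GG ap_N ap_d)+
  have G_part: "1 / 2 * (ap_norm (opG q m (\<phi> (n + 1))))\<^sup>2 - 1 / 2 * (ap_norm (opG q m (\<phi> n)))\<^sup>2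
      = ap_mean (\<lambda>r. GG r * d r)"
    unfolding half_norm_difference_opG[OF reg(1,2)] GG_def half d_def by (simp add: ap_inner_eq_mean)
  have "(\<R> (n + 1) - \<R> n) / \<tau> n = ap_mean (\<lambda>r. N r / (2 * s) * (d r / \<tau> n))"
    using scheme_R[OF n] by (simp add: ap_inner_eq_mean N_def s_def d_def)
  also have "\<dots> = ap_mean (\<lambda>r. 1 / (2 * s * \<tau> n) * (N r * d r))"
    by (rule arg_cong[of _ _ ap_mean]) auto
  also have "\<dots> = 1 / (2 * s * \<tau> n) * ap_mean (\<lambda>r. N r * d r)"
    by (rule ap_mean_cmult[OF ap_Nd])
  \<comment> \<open>If \<open>s = 0\<close>, the convention \<open>x / 0 = 0\<close> makes this increment vanish along with the nonlinear term of \<open>W\<close>.\<close>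
  finally have "\<R> (n + 1) - \<R> n = 1 / (2 * s) * ap_mean (\<lambda>r. N r * d r)"
    using tau by (simp add: divide_eq_eq)
  moreover have "(\<R> (n + 1))\<^sup>2 - (\<R> n)\<^sup>2 = 2 * R_half \<R> n * (\<R> (n + 1) - \<R> n)"
    by (simp add: R_half_def power2_eq_square algebra_simps)
  ultimately have R_part: "(\<R> (n + 1))\<^sup>2 - (\<R> n)\<^sup>2 = R_half \<R> n / s * ap_mean (\<lambda>r. N r * d r)"
    by simp
  have "modified_energy q m C1 \<phi> \<R> (n + 1) - modified_energy q m C1 \<phi> \<R> n
      = ap_mean (\<lambda>r. 1 * (GG r * d r) + R_half \<R> n / s * (N r * d r))"
    using G_part R_part unfolding modified_energy_def ap_mean_lincomb[OF ap_GGd ap_Nd] by simp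
  also have "\<dots> = ap_mean (\<lambda>r. (- 1 / \<tau> n) * (d r * d r))"
  proof (rule arg_cong[of _ _ ap_mean], rule ext)
    fix r
    have "d r / \<tau> n = - W n r" using scheme_phi[OF n] by (simp only: d_def)
    moreover have "W n r = GG r + R_half \<R> n / s * N r"
      using scheme_W[OF n] by (simp only: GG_def N_def s_def)
    ultimately have "GG r + R_half \<R> n / s * N r = - d r / \<tau> n" by simp
    then have "(GG r + R_half \<R> n / s * N r) * d r = - d r / \<tau> n * d r" by simp
    then show "1 * (GG r * d r) + R_half \<R> n / s * (N r * d r) = (- 1 / \<tau> n) * (d r * d r)"
      by (simp add: algebra_simps)
  qed
  also have "\<dots> = (- 1 / \<tau> n) * ap_mean (\<lambda>r. d r * d r)" by (rule ap_mean_cmult[OF ap_dd])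
  also have "\<dots> \<le> 0" using ap_mean_nonneg[OF ap_dd] tau by simp
  finally show "modified_energy q m C1 \<phi> \<R> (n + 1) - modified_energy q m C1 \<phi> \<R> n \<le> 0" .
qed

end
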